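(* Let $S\in\mathbb{M}_n(\mathbb{R})$ be a stochastic matrix, acting on the abelian $C^*$-algebra $\mathbb{C}^n$, and let $\mathfrak{A}_S$ be the $C^*$-algebra whose underlying space is $P_S\mathbb{C}^n$, with the involution, norm and unit inherited from $\mathbb{C}^n$ and with product $a\circ b:=P_S(ab)$. Then the restriction $S\lceil_{\mathfrak{A}_S}$ of $S$ to $\mathfrak{A}_S$ is a $*$-automorphism of the $C^*$-algebra $\mathfrak{A}_S$.
   Context: A stochastic matrix $S\in\mathbb{M}_n(\mathbb{R})$ is a matrix with entries $S_{ij}\ge 0$ and $S\mathbf{1}=\mathbf{1}$, where $\mathbf{1}=(1,\dots,1)^T$; equivalently, it is a unital (completely) positive linear map of the $C^*$-algebra $\mathbb{C}^n$ (entrywise product, entrywise complex conjugation as involution, sup norm) into itself, acting on column vectors. The peripheral spectrum of $S$ is $\sigma_{\rm ph}(S)=\{\lambda\in\sigma(S): |\lambda|={\rm spr}(S)\}$, where ${\rm spr}(S)=1$ is the spectral radius. Put $Q_S:=\frac{1}{2\pi\imath}\oint_\gamma(\lambda I-S)^{-1}\,d\lambda$, with $\gamma$ a counterclockwise Jordan curve inside the open unit disk surrounding $\sigma(S)\smallsetminus\sigma_{\rm ph}(S)$ (so $Q_S=0$ if this set is empty), and $P_S:=I-Q_S$. Thus $P_S$ is the spectral (Riesz) projection of $S$ associated with its peripheral spectrum. It commutes with $S$, so $S$ maps $P_S\mathbb{C}^n$ into itself. The space $P_S\mathbb{C}^n$ is a selfadjoint linear subspace of $\mathbb{C}^n$ containing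 $\mathbf{1}$. By a theorem of Choi and Effros, $P_S\mathbb{C}^n$ equipped with the unit $\mathbf{1}$, the involution and norm of $\mathbb{C}^n$, and the product $a\circ b:=P_S(ab)$ (where $ab$ is the entrywise product in $\mathbb{C}^n$) is a unital abelian $C^*$-algebra, denoted $\mathfrak{A}_S$. *)

theory Defs
  imports "HOL-Complex_Analysis.Complex_Analysis" "HOL-Algebra.Module" "HOL-Algebra.QuotRing"
begin

no_notation fps_nth (infixl \<open>$\<close> 75)

section \<open>Unital abelian C*-algebras and their automorphisms\<close>

definition complex_ring :: "complex ring"
  where "complex_ring = \<lparr>carrier = UNIV, mult = (*), one = 1, zero = 0, add = (+)\<rparr>"

record 'a cstar = "(complex, 'a) module" +
  star :: "'a \<Rightarrow> 'a"
  cnorm :: "'a \<Rightarrow> real"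

text \<open>
  The locale \<open>Module.algebra\<close> makes \<open>A\<close> a commutative ring with unit.  The last axiom says
  that \<open>A\<close> is complete in its norm.
\<close>

locale abelian_cstar_algebra = Module.algebra complex_ring A for A :: "'a cstar" +
  assumes star_closed: "x \<in> carrier A \<Longrightarrow> star A x \<in> carrier A"
    and star_star: "x \<in> carrier A \<Longrightarrow> star A (star A x) = x"
    and star_add: "\<lbrakk>x \<in> carrier A; y \<in> carrier A\<rbrakk> \<Longrightarrow>
      star A (x \<oplus>\<^bsub>A\<^esub> y) = star A x \<oplus>\<^bsub>A\<^esub> star A y"
    and star_smult: "x \<in> carrier A \<Longrightarrow> star A (c \<odot>\<^bsub>A\<^esub> x) = cnj c \<odot>\<^bsub>A\<^esub> star A x"
    and star_mult: "\<lbrakk>x \<in> carrier A; y \<in> carrier A\<rbrakk> \<Longrightarrow>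
      star A (x \<otimes>\<^bsub>A\<^esub> y) = star A y \<otimes>\<^bsub>A\<^esub> star A x"
    and cnorm_nonneg: "x \<in> carrier A \<Longrightarrow> 0 \<le> cnorm A x"
    and cnorm_eq_0_iff: "x \<in> carrier A \<Longrightarrow> cnorm A x = 0 \<longleftrightarrow> x = \<zero>\<^bsub>A\<^esub>"
    and cnorm_smult: "x \<in> carrier A \<Longrightarrow> cnorm A (c \<odot>\<^bsub>A\<^esub> x) = cmod c * cnorm A x"
    and cnorm_triangle: "\<lbrakk>x \<in> carrier A; y \<in> carrier A\<rbrakk> \<Longrightarrow>
      cnorm A (x \<oplus>\<^bsub>A\<^esub> y) \<le> cnorm A x + cnorm A y"
    and cnorm_mult_le: "\<lbrakk>x \<in> carrier A; y \<in> carrier A\<rbrakk> \<Longrightarrow>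
      cnorm A (x \<otimes>\<^bsub>A\<^esub> y) \<le> cnorm A x * cnorm A y"
    and cstar_identity: "x \<in> carrier A \<Longrightarrow> cnorm A (star A x \<otimes>\<^bsub>A\<^esub> x) = (cnorm A x)\<^sup>2"
    and complete: "\<lbrakk>\<And>k::nat. X k \<in> carrier A;
        \<And>e. e > 0 \<Longrightarrow> \<exists>N. \<forall>j\<ge>N. \<forall>k\<ge>N. cnorm A (X j \<ominus>\<^bsub>A\<^esub> X k) < e\<rbrakk> \<Longrightarrow>
      \<exists>x\<in>carrier A. (\<lambda>k. cnorm A (X k \<ominus>\<^bsub>A\<^esub> x)) \<longlonglongrightarrow> 0"

text \<open>
  Unital, additive, multiplicative and bijective is \<^const>\<open>ring_iso\<close>.  That \<open>A\<close> really is a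
  C*-algebra is part of what it means to have a *-automorphism of it.
\<close>

locale star_automorphism = abelian_cstar_algebra A for A :: "'a cstar" +
  fixes f :: "'a \<Rightarrow> 'a"
  assumes ring_iso: "f \<in> ring_iso A A"
    and map_smult: "x \<in> carrier A \<Longrightarrow> f (c \<odot>\<^bsub>A\<^esub> x) = c \<odot>\<^bsub>A\<^esub> f x"
    and map_star: "x \<in> carrier A \<Longrightarrow> f (star A x) = star A (f x)"


section \<open>The peripheral spectral projection of a stochastic matrix\<close>

definition stochastic :: "real^'n^'n \<Rightarrow> bool"
  where "stochastic S \<longleftrightarrow> (\<forall>i j. 0 \<le> S $ i $ j) \<and> S *v 1 = 1"

definition cmat :: "real^'n^'n \<Rightarrow> complex^'n^'n"
  where "cmat S = (\<chi> i j. complex_of_real (S $ i $ j))"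

definition spectrum :: "complex^'n^'n \<Rightarrow> complex set"
  where "spectrum T = {z. \<not> invertible (mat z - T)}"

definition spr :: "complex^'n^'n \<Rightarrow> real"
  where "spr T = (SUP z\<in>spectrum T. cmod z)"

definition peripheral_spectrum :: "complex^'n^'n \<Rightarrow> complex set"
  where "peripheral_spectrum T = {z \<in> spectrum T. cmod z = spr T}"

text \<open>
  Counterclockwise (piecewise continuously differentiable) Jordan curves in the open unit disk
  that surround the non-peripheral part of the spectrum.
\<close>

definition riesz_contour :: "complex^'n^'n \<Rightarrow> (real \<Rightarrow> complex) \<Rightarrow> bool"
  where "riesz_contour T \<gamma> \<longleftrightarrow>
    valid_path \<gamma> \<and> simple_path \<gamma> \<and> pathfinish \<gamma> = pathstart \<gamma> \<and>
    (\<forall>z \<in> inside (path_image \<gamma>). winding_number \<gamma> z = 1) \<and>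
    path_image \<gamma> \<subseteq> ball 0 1 \<and>
    spectrum T - peripheral_spectrum T \<subseteq> inside (path_image \<gamma>)"

lemma spectrum_iff: "z \<in> spectrum T \<longleftrightarrow> (\<exists>v. v \<noteq> 0 \<and> T *v v = z *s v)"
proof -
  have "invertible (mat z - T) \<longleftrightarrow> (\<forall>v. (mat z - T) *v v = 0 \<longrightarrow> v = 0)"
    by (metis invertible_left_inverse matrix_left_invertible_ker)
  moreover have "(mat z - T) *v v = z *s v - T *v v" for v
    unfolding matrix_vector_mult_diff_rdistrib
    by (simp add: vec_eq_iff matrix_vector_mult_def mat_def if_distrib[of "\<lambda>x. x * _"] cong: if_cong)
  ultimately show ?thesis unfolding spectrum_def by auto
qed

lemma stochastic_spectrum:
  assumes st: "stochastic S"
  shows "finite (spectrum (cmat S))"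
    and "z \<in> spectrum (cmat S) \<Longrightarrow> cmod z \<le> 1"
    and "1 \<in> spectrum (cmat S)"
proof -
  let ?T = "cmat S"
  have pos: "\<And>i j. 0 \<le> S$i$j" and row: "\<And>i. (\<Sum>j\<in>UNIV. S$i$j) = 1"
    using st by (auto simp: stochastic_def vec_eq_iff matrix_vector_mult_def)
  show le: "cmod z \<le> 1" if z: "z \<in> spectrum ?T" for z
  proof -
    obtain v where v: "v \<noteq> 0" "?T *v v = z *s v" using z unfolding spectrum_iff by blast
    obtain i where i: "cmod (v$i) = (MAX i. cmod (v$i))"
      using Max_in[of "range (\<lambda>i. cmod (v$i))"] by fastforce
    have mx: "cmod (v$j) \<le> cmod (v$i)" for j unfolding i by simp
    have "v$i \<noteq> 0" using mx v(1) by (auto simp: vec_eq_iff)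
    have "z * v$i = (\<Sum>j\<in>UNIV. of_real (S$i$j) * v$j)"
      using arg_cong[OF v(2), of "\<lambda>w. w$i"] by (simp add: cmat_def matrix_vector_mult_def)
    then have "cmod z * cmod (v$i) = cmod (\<Sum>j\<in>UNIV. of_real (S$i$j) * v$j)"
      by (simp flip: norm_mult)
    also have "\<dots> \<le> (\<Sum>j\<in>UNIV. cmod (of_real (S$i$j) * v$j))"
      by (rule norm_sum)
    also have "\<dots> \<le> (\<Sum>j\<in>UNIV. S$i$j * cmod (v$i))"
      by (intro sum_mono) (simp add: norm_mult pos mx mult_left_mono)
    also have "\<dots> = cmod (v$i)" by (simp add: sum_distrib_right[symmetric] row)
    finally show ?thesis using \<open>v$i \<noteq> 0\<close> by simp
  qed
  show "1 \<in> spectrum ?T"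
    unfolding spectrum_iff
    by (rule exI[of _ 1]) (use row in \<open>auto simp: vec_eq_iff matrix_vector_mult_def cmat_def simp flip: of_real_sum\<close>)
  define p where "p = det (\<chi> i j. (if i = j then [:0,1:] else 0) - [: ?T$i$j :])"
  have p: "poly p z = det (mat z - ?T)" for z
    unfolding p_def det_def by (simp add: poly_sum poly_prod mat_def if_distrib[of "\<lambda>q. poly q z"] cong: if_cong)
  have sp: "spectrum ?T = {z. poly p z = 0}"
    unfolding spectrum_def p invertible_det_nz by simp
  have "p \<noteq> 0"
  proof
    assume "p = 0" then have "2 \<in> spectrum ?T" unfolding sp by simp
    from le[OF this] show False by simp
  qed
  then show "finite (spectrum ?T)" unfolding sp by (rule poly_roots_finite)
qed

lemma stochastic_spr:
  assumes st: "stochastic S"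
  shows "spr (cmat S) = 1"
  unfolding spr_def
proof (rule cSup_eq_maximum)
  show "1 \<in> cmod ` spectrum (cmat S)"
    using stochastic_spectrum(3)[OF st] by (metis image_eqI norm_one)
  show "x \<le> 1" if "x \<in> cmod ` spectrum (cmat S)" for x
    using that stochastic_spectrum(2)[OF st] by blast
qed

lemma riesz_contour_exists:
  assumes st: "stochastic S"
  shows "\<exists>\<gamma>. riesz_contour (cmat S) \<gamma>"
proof -
  let ?T = "cmat S" let ?N = "spectrum ?T - peripheral_spectrum ?T"
  have fin: "finite ?N"
    using stochastic_spectrum(1)[OF st] by simp
  have lt: "cmod z < 1" if "z \<in> ?N" for z
    using that stochastic_spectrum(2)[OF st, of z] stochastic_spr[OF st]
    by (auto simp: peripheral_spectrum_def)
  note N = fin lt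
  define m where "m = Max (insert 0 (cmod ` ?N))"
  define r where "r = (m + 1) / 2"
  have m: "0 \<le> m" "\<And>z. z \<in> ?N \<Longrightarrow> cmod z \<le> m" using N(1) by (auto simp: m_def)
  have "m < 1" unfolding m_def using N by (subst Max_less_iff) auto
  have r: "0 < r" "m < r" "r < 1" using m \<open>m < 1\<close> by (auto simp: r_def)
  have ins: "inside (path_image (circlepath 0 r)) = ball 0 r"
    using r inside_frontier_eq_interior[of "cball (0::complex) r"] by simp
  have "riesz_contour ?T (circlepath 0 r)"
    unfolding riesz_contour_def ins
  proof (intro conjI ballI)
    show "winding_number (circlepath 0 r) z = 1" if "z \<in> ball 0 r" for z
      using that r by (intro winding_number_circlepath) (auto simp: dist_norm)
    show "?N \<subseteq> ball 0 r" using m r by force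
    show "simple_path (circlepath 0 r)" using r by (simp add: simple_path_circlepath)
  qed (use r in \<open>auto\<close>)
  then show ?thesis by blast
qed

text \<open>The matrix-valued contour integral is taken entrywise.\<close>

definition Q_proj :: "complex^'n^'n \<Rightarrow> (real \<Rightarrow> complex) \<Rightarrow> complex^'n^'n"
  where "Q_proj T \<gamma> = (\<chi> i j. 1 / (2 * of_real pi * \<i>) *
    contour_integral \<gamma> (\<lambda>z. matrix_inv (mat z - T) $ i $ j))"

definition P_proj :: "complex^'n^'n \<Rightarrow> (real \<Rightarrow> complex) \<Rightarrow> complex^'n^'n"
  where "P_proj T \<gamma> = mat 1 - Q_proj T \<gamma>"


section \<open>The algebra carried by the range of the projection\<close>

definition cnj_vec :: "complex^'n \<Rightarrow> complex^'n"
  where "cnj_vec a = (\<chi> i. cnj (a $ i))"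

definition sup_norm :: "complex^'n \<Rightarrow> real"
  where "sup_norm a = (MAX i. cmod (a $ i))"

text \<open>The library's product \<open>a * b\<close> and unit \<open>1\<close> on vectors are the entrywise ones.\<close>

definition range_algebra :: "complex^'n^'n \<Rightarrow> (complex^'n) cstar"
  where "range_algebra P =
    \<lparr>carrier = range (\<lambda>a. P *v a), mult = (\<lambda>a b. P *v (a * b)), one = 1, zero = 0, add = (+),
     smult = (*s), star = cnj_vec, cnorm = sup_norm\<rparr>"

definition peripheral_algebra :: "real^'n^'n \<Rightarrow> (real \<Rightarrow> complex) \<Rightarrow> (complex^'n) cstar"
  where "peripheral_algebra S \<gamma> = range_algebra (P_proj (cmat S) \<gamma>)"

end

theory Submission
  imports Defs
begin

text \<open>
  By compactness, a sequence of powers of \<open>S\<close> converges to a stochastic idempotent \<open>E\<close>, and there is a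
  stochastic matrix \<open>B\<close> with \<open>S B = B S = E\<close> (\<open>stochastic_idempotent_limit\<close>).  This \<open>E\<close> is the
  peripheral spectral projection, whatever the curve (\<open>P_proj_eq_idempotent\<close>): on the range
  of \<open>E\<close> the eigenvalues of \<open>S\<close> have modulus \<open>1\<close>, because both \<open>S\<close> and its inverse \<open>B\<close> there
  are stochastic, and on the kernel of \<open>E\<close> they have modulus less than \<open>1\<close>, because a sequence of
  powers tends to \<open>0\<close> there.  In particular the projection is a positive unital map.

  For a positive unital map \<open>S\<close> the Schwarz inequality \<open>|S a|\<^sup>2 \<le> S |a|\<^sup>2\<close> holds, and the difference
  of the two sides consists of variances.  If \<open>S\<close> has a positive unital inverse at \<open>a\<close>, these
  variances are annihilated by \<open>E\<close>, and therefore \<open>E (S a S b) = E S (a b)\<close> for all \<open>b\<close>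
  (\<open>stochastic_multiplicative_domain\<close>).  With \<open>E\<close> in place of \<open>S\<close> this is the Choi--Effros
  identity \<open>E (a E b) = E (a b)\<close>, the key to the C*-algebra structure on the range of \<open>E\<close>
  (\<open>abelian_cstar_algebra_range\<close>); with \<open>S\<close> itself it says that \<open>S\<close> is multiplicative on that
  algebra.  There \<open>S\<close> is bijective with inverse \<open>B\<close>, and it commutes with complex conjugation because
  its entries are real.
\<close>

section \<open>An idempotent limit of powers of a stochastic matrix\<close>

text \<open>Matrix powers; the power operation \<open>^\<close> on matrices is the entrywise one.\<close>

definition mpow :: "'a::semiring_1^'n^'n \<Rightarrow> nat \<Rightarrow> 'a^'n^'n"
  where "mpow A k = (((**) A) ^^ k) (mat 1)"

lemma mpow_0 [simp]: "mpow A 0 = mat 1"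
  and mpow_Suc [simp]: "mpow A (Suc k) = A ** mpow A k"
  by (simp_all add: mpow_def)

lemma mpow_add: "mpow A (m + k) = mpow A m ** mpow A k"
  by (induction m) (simp_all add: matrix_mul_assoc)

lemma stochastic_nonneg: "stochastic S \<Longrightarrow> 0 \<le> S $ i $ j"
  and stochastic_row_sum: "stochastic S \<Longrightarrow> (\<Sum>j\<in>UNIV. S $ i $ j) = 1"
  by (auto simp: stochastic_def vec_eq_iff matrix_vector_mult_def)

lemma stochastic_mat_1: "stochastic (mat 1)"
  by (auto simp: stochastic_def) (simp add: mat_def)

lemma stochastic_mult: "stochastic A \<Longrightarrow> stochastic B \<Longrightarrow> stochastic (A ** B)"
  unfolding stochastic_def
  by (auto simp: matrix_vector_mul_assoc[symmetric])
     (simp add: matrix_matrix_mult_def sum_nonneg)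

lemma stochastic_mpow: "stochastic S \<Longrightarrow> stochastic (mpow S k)"
  by (induction k) (simp_all add: stochastic_mat_1 stochastic_mult)

lemma tendsto_matrix_mult:
  fixes f :: "'b \<Rightarrow> 'a::real_normed_algebra_1^'n^'m" and g :: "'b \<Rightarrow> 'a^'k^'n"
  assumes "(f \<longlongrightarrow> A) F" "(g \<longlongrightarrow> B) F"
  shows "((\<lambda>x. f x ** g x) \<longlongrightarrow> A ** B) F"
  unfolding matrix_matrix_mult_def by (intro tendsto_intros assms)

lemma stochastic_limit:
  fixes X :: "nat \<Rightarrow> real^'n^'n"
  assumes "\<And>k. stochastic (X k)" "X \<longlonglongrightarrow> A"
  shows "stochastic A"
proof -
  have lim: "(\<lambda>k. X k $ i $ j) \<longlonglongrightarrow> A $ i $ j" for i j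
    by (intro tendsto_vec_nth assms)
  have "0 \<le> A $ i $ j" for i j
    by (rule LIMSEQ_le_const[OF lim]) (use assms(1) stochastic_nonneg in blast)
  moreover have "(\<Sum>j\<in>UNIV. A $ i $ j) = 1" for i
  proof (rule LIMSEQ_unique)
    show "(\<lambda>k. \<Sum>j\<in>UNIV. X k $ i $ j) \<longlonglongrightarrow> (\<Sum>j\<in>UNIV. A $ i $ j)"
      by (intro tendsto_sum lim)
  qed (simp add: stochastic_row_sum[OF assms(1)])
  ultimately show ?thesis
    by (simp add: stochastic_def vec_eq_iff matrix_vector_mult_def)
qed

lemma norm_stochastic_le:
  fixes A :: "real^'n^'n"
  assumes "stochastic A" shows "norm A \<le> CARD('n)"
proof -
  have "norm A \<le> (\<Sum>i\<in>UNIV. norm (A $ i))"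
    unfolding norm_vec_def by (intro L2_set_le_sum) auto
  also have "\<dots> \<le> (\<Sum>i\<in>(UNIV::'n set). 1)"
  proof (rule sum_mono)
    fix i
    have "norm (A $ i) \<le> (\<Sum>j\<in>UNIV. \<bar>A $ i $ j\<bar>)" by (rule norm_le_l1_cart)
    then show "norm (A $ i) \<le> 1"
      using assms by (simp add: stochastic_nonneg stochastic_row_sum)
  qed
  finally show ?thesis by simp
qed

lemma stochastic_convergent_subseq:
  fixes X :: "nat \<Rightarrow> real^'n^'n"
  assumes "\<And>k. stochastic (X k)"
  obtains A r where "stochastic A" "strict_mono r" "(\<lambda>k. X (r k)) \<longlonglongrightarrow> A"
proof -
  have "bounded (range X)"
    unfolding bounded_iff using norm_stochastic_le[OF assms] by blast
  then obtain A r where r: "strict_mono r" "(X \<circ> r) \<longlonglongrightarrow> A"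
    using bounded_imp_convergent_subsequence[of X] by blast
  then have lim: "(\<lambda>k. X (r k)) \<longlonglongrightarrow> A" by (simp add: o_def)
  show thesis
    by (rule that[OF stochastic_limit[OF _ lim] r(1) lim]) (rule assms)
qed

text \<open>
  The limit points of the powers of \<open>S\<close> form a group, of which \<open>E\<close> is the unit and \<open>B\<close> the inverse of
  \<open>S E\<close>.  Only these two elements are needed: given \<open>S\<^sup>r \<rightarrow> A\<close> along a subsequence, a second
  subsequence provides \<open>C\<close> with \<open>A = A A C S\<close>, so that \<open>E = A C S\<close> satisfies \<open>A E = A\<close>, hence
  \<open>E E = E\<close>, and \<open>B = A C\<close> satisfies \<open>S B = E\<close>.
\<close>
lemma stochastic_idempotent_limit:
  fixes S :: "real^'n^'n"
  assumes S: "stochastic S"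
  obtains E B k where "stochastic E" "stochastic B" "E ** E = E" "S ** B = E" "B ** S = E"
    "S ** E = E ** S" "B ** E = E ** B" "(\<lambda>j. mpow S (Suc (k j))) \<longlonglongrightarrow> E"
proof -
  obtain A r where A: "stochastic A" and r: "strict_mono r" and rA: "(\<lambda>j. mpow S (r j)) \<longlonglongrightarrow> A"
    using stochastic_convergent_subseq[OF stochastic_mpow[OF S], of "\<lambda>j. j"] by blast
  \<comment> \<open>The exponent \<open>r (s j)\<close> is at least \<open>s j\<close>, so that it splits as \<open>r j + (1 + r j + l j)\<close>.\<close>
  define s where "s j = Suc (2 * r j)" for j
  define l where "l j = r (s j) - s j" for j
  have l: "r (s j) = l j + s j" for j
    using seq_suble[OF r, of "s j"] by (simp add: l_def)
  obtain C u where C: "stochastic C" and u: "strict_mono u" and uC: "(\<lambda>j. mpow S (l (u j))) \<longlonglongrightarrow> C"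
    using stochastic_convergent_subseq[OF stochastic_mpow[OF S], of l] by blast
  have uA: "(\<lambda>j. mpow S (r (u j))) \<longlonglongrightarrow> A"
    using LIMSEQ_subseq_LIMSEQ[OF rA u] by (simp add: o_def)
  have "strict_mono s" using r by (auto simp: s_def strict_mono_def)
  then have "strict_mono (\<lambda>j. s (u j))" using u by (auto simp: strict_mono_def)
  then have sA: "(\<lambda>j. mpow S (r (s (u j)))) \<longlonglongrightarrow> A"
    using LIMSEQ_subseq_LIMSEQ[OF rA] unfolding o_def by blast
  have comm: "X ** Y = Y ** X" if "(\<lambda>j. mpow S (f j)) \<longlonglongrightarrow> X" "(\<lambda>j. mpow S (g j)) \<longlonglongrightarrow> Y" for X Y f g
  proof (rule LIMSEQ_unique)
    show "(\<lambda>j. mpow S (f j) ** mpow S (g j)) \<longlonglongrightarrow> X ** Y"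
      by (intro tendsto_matrix_mult that)
    show "(\<lambda>j. mpow S (f j) ** mpow S (g j)) \<longlonglongrightarrow> Y ** X"
      using tendsto_matrix_mult[OF that(2,1)] by (simp add: mpow_add[symmetric] add.commute)
  qed
  have S1: "(\<lambda>j. mpow S (Suc 0)) \<longlonglongrightarrow> S" by simp
  define B where "B = A ** C"
  define E where "E = S ** B"
  have B: "(\<lambda>j. mpow S (r (u j) + l (u j))) \<longlonglongrightarrow> B"
    unfolding B_def mpow_add by (intro tendsto_matrix_mult uA uC)
  have E: "(\<lambda>j. mpow S (Suc (r (u j) + l (u j)))) \<longlonglongrightarrow> E"
    unfolding E_def mpow_Suc by (intro tendsto_matrix_mult tendsto_const B)
  have "r (s j) = r j + Suc (r j + l j)" for j
    using l[of j] by (simp add: s_def)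
  then have "mpow S (r (s j)) = mpow S (r j) ** mpow S (Suc (r j + l j))" for j
    by (simp only: mpow_add)
  then have "(\<lambda>j. mpow S (r (s (u j)))) \<longlonglongrightarrow> A ** E"
    using tendsto_matrix_mult[OF uA E] by (simp only:)
  with sA have AE: "A ** E = A" using LIMSEQ_unique by blast
  have E_AC: "E = A ** (C ** S)"
    using comm[OF S1 B] by (simp add: E_def B_def matrix_mul_assoc)
  have "E ** E = E ** (A ** (C ** S))" by (subst (2) E_AC) (rule refl)
  also have "\<dots> = (A ** E) ** (C ** S)" by (simp only: matrix_mul_assoc comm[OF uA E])
  also have "\<dots> = E" by (simp only: AE E_AC[symmetric])
  finally have "E ** E = E" .
  moreover have "stochastic B" unfolding B_def by (intro stochastic_mult A C)
  moreover have "stochastic E" unfolding E_def by (intro stochastic_mult S \<open>stochastic B\<close>)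
  moreover have "S ** B = E" by (simp only: E_def)
  moreover have "B ** S = E" using comm[OF S1 B] by (simp only: E_def)
  ultimately show thesis
    by (intro that[OF _ _ _ _ _ comm[OF S1 E] comm[OF B E] E])
qed

section \<open>Stochastic matrices as positive unital maps\<close>

lemma cmat_mult: "cmat (A ** B) = cmat A ** cmat B"
  by (simp add: cmat_def matrix_matrix_mult_def vec_eq_iff)

lemma cmat_mat_1: "cmat (mat 1) = mat 1"
  by (simp add: cmat_def mat_def vec_eq_iff)

lemma cmat_nth: "(cmat S *v a) $ i = (\<Sum>j\<in>UNIV. complex_of_real (S $ i $ j) * a $ j)"
  by (simp add: cmat_def matrix_vector_mult_def)

lemma cmat_stochastic_one: "stochastic S \<Longrightarrow> cmat S *v 1 = 1"
  using stochastic_row_sum by (auto simp: vec_eq_iff cmat_nth simp flip: of_real_sum)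

lemma tendsto_cmat: "(f \<longlongrightarrow> A) F \<Longrightarrow> ((\<lambda>x. cmat (f x)) \<longlongrightarrow> cmat A) F"
  unfolding cmat_def by (intro tendsto_intros)

text \<open>The entrywise squared modulus \<open>a\<^sup>* a\<close>, as a real vector.\<close>

definition abs2 :: "complex^'n \<Rightarrow> real^'n"
  where "abs2 a = (\<chi> i. (cmod (a $ i))\<^sup>2)"

text \<open>
  Row \<open>i\<close> of \<open>S\<close> is a probability distribution on the indices; the left-hand side is the variance of
  \<open>a\<close> under it.
\<close>
lemma stochastic_variance:
  fixes S :: "real^'n^'n"
  assumes S: "stochastic S"
  shows "(\<Sum>j\<in>UNIV. S $ i $ j * (cmod (a $ j - (cmat S *v a) $ i))\<^sup>2) =
    (S *v abs2 a) $ i - (cmod ((cmat S *v a) $ i))\<^sup>2"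
proof -
  have sq: "(complex_of_real (cmod z))\<^sup>2 = z * cnj z" for z
    using complex_norm_square[of z] by simp
  define m where "m = (cmat S *v a) $ i"
  have m: "(\<Sum>j\<in>UNIV. of_real (S $ i $ j) * a $ j) = m"
    by (simp add: m_def cmat_nth)
  from arg_cong[OF this, of cnj] have cm: "(\<Sum>j\<in>UNIV. cnj (of_real (S $ i $ j) * a $ j)) = cnj m"
    by (simp only: cnj_sum)
  have "complex_of_real (S $ i $ j * (cmod (a $ j - m))\<^sup>2) =
      of_real (S $ i $ j * (cmod (a $ j))\<^sup>2) - (of_real (S $ i $ j) * a $ j) * cnj m
      - cnj (of_real (S $ i $ j) * a $ j) * m + of_real (S $ i $ j) * (m * cnj m)" for j
    by (simp add: sq algebra_simps)
  then have "complex_of_real (\<Sum>j\<in>UNIV. S $ i $ j * (cmod (a $ j - m))\<^sup>2) =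
      of_real (\<Sum>j\<in>UNIV. S $ i $ j * (cmod (a $ j))\<^sup>2) - m * cnj m - cnj m * m
      + of_real (\<Sum>j\<in>UNIV. S $ i $ j) * (m * cnj m)"
    by (simp only: of_real_sum sum.distrib sum_subtractf sum_distrib_right[symmetric] m cm)
  also have "\<dots> = complex_of_real ((S *v abs2 a) $ i - (cmod m)\<^sup>2)"
    using S by (simp add: stochastic_row_sum sq mult.commute matrix_vector_mult_def abs2_def)
  finally show ?thesis unfolding m_def of_real_eq_iff .
qed

text \<open>The Kadison--Schwarz inequality \<open>|S a|\<^sup>2 \<le> S |a|\<^sup>2\<close>.\<close>
lemma stochastic_Schwarz:
  assumes S: "stochastic S"
  shows "(cmod ((cmat S *v a) $ i))\<^sup>2 \<le> (S *v abs2 a) $ i"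
proof -
  have "0 \<le> (\<Sum>j\<in>UNIV. S $ i $ j * (cmod (a $ j - (cmat S *v a) $ i))\<^sup>2)"
    by (intro sum_nonneg) (simp add: stochastic_nonneg[OF S])
  then show ?thesis unfolding stochastic_variance[OF S] by simp
qed

lemma stochastic_mono:
  assumes "stochastic S" "\<And>j. x $ j \<le> y $ j"
  shows "(S *v x) $ i \<le> (S *v y) $ i"
  unfolding matrix_vector_mult_def vec_lambda_beta
  by (intro sum_mono mult_left_mono stochastic_nonneg assms)

text \<open>
  If \<open>S\<close> is inverted at \<open>a\<close> by a stochastic matrix, the Schwarz inequality for the inverse
  shows that the variances of \<open>a\<close> under the rows of \<open>S\<close> vanish as far as \<open>E\<close> can see:
  \<open>E (S |a|\<^sup>2 - |S a|\<^sup>2) \<le> 0\<close>.  Hence \<open>a\<close> is constant, with value \<open>(S a)\<^sub>k\<close>, on the support of each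
  row \<open>k\<close> of \<open>S\<close> that \<open>E\<close> charges, and can be pulled out of \<open>S (a b)\<close> there.
\<close>
lemma stochastic_multiplicative_domain:
  fixes a b :: "complex^'n"
  assumes E: "stochastic E" "E ** E = E" and S: "stochastic S" and B: "stochastic B" "S ** B = E"
    and a: "cmat B *v (cmat S *v a) = a"
  shows "cmat E *v ((cmat S *v a) * (cmat S *v b)) = cmat E *v (cmat S *v (a * b))"
proof -
  let ?v = "cmat S *v a"
  define D where "D k = (\<Sum>j\<in>UNIV. S $ k $ j * (cmod (a $ j - ?v $ k))\<^sup>2)" for k
  have D0: "0 \<le> D k" for k
    unfolding D_def by (intro sum_nonneg) (simp add: stochastic_nonneg[OF S])
  \<comment> \<open>A sum of nonnegative terms, which the Schwarz inequality for \<open>B\<close> bounds by \<open>0\<close>.\<close>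
  have ED: "E $ i $ k * D k = 0" for i k
  proof -
    have "abs2 a $ j \<le> (B *v abs2 ?v) $ j" for j
      using stochastic_Schwarz[OF B(1), of ?v j] by (simp add: a abs2_def)
    from stochastic_mono[OF stochastic_mult[OF E(1) S] this]
    have "((E ** S) *v abs2 a) $ i \<le> ((E ** S) *v (B *v abs2 ?v)) $ i" .
    also have "\<dots> = (E *v abs2 ?v) $ i"
      by (simp add: matrix_vector_mul_assoc matrix_mul_assoc[symmetric] B(2) E(2))
    finally have "(E *v (S *v abs2 a - abs2 ?v)) $ i \<le> 0"
      by (simp add: matrix_vector_mul_assoc matrix_vector_mult_diff_distrib)
    moreover have "S *v abs2 a - abs2 ?v = (\<chi> k. D k)"
      by (simp add: vec_eq_iff D_def stochastic_variance[OF S]) (simp add: abs2_def)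
    ultimately have "(E *v (\<chi> k. D k)) $ i \<le> 0" by simp
    then have "(\<Sum>k\<in>UNIV. E $ i $ k * D k) \<le> 0"
      by (simp add: matrix_vector_mult_def)
    moreover have nonneg: "0 \<le> E $ i $ k * D k" for k
      by (simp add: D0 stochastic_nonneg[OF E(1)])
    ultimately have "(\<Sum>k\<in>UNIV. E $ i $ k * D k) = 0"
      by (intro antisym sum_nonneg)
    then show ?thesis
      using sum_nonneg_eq_0_iff[of UNIV "\<lambda>k. E $ i $ k * D k"] nonneg by simp
  qed
  have const: "complex_of_real (E $ i $ k) * (of_real (S $ k $ j) * (?v $ k * b $ j)) =
      of_real (E $ i $ k) * (of_real (S $ k $ j) * (a $ j * b $ j))" for i j k
  proof (cases "E $ i $ k = 0")
    case False
    then have "D k = 0" using ED[of i k] by simp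
    then have "S $ k $ j * (cmod (a $ j - ?v $ k))\<^sup>2 = 0"
      unfolding D_def using sum_nonneg_eq_0_iff[of UNIV "\<lambda>j. S $ k $ j * (cmod (a $ j - ?v $ k))\<^sup>2"]
      by (simp add: stochastic_nonneg[OF S])
    then show ?thesis by auto
  qed simp
  have "(cmat E *v (?v * (cmat S *v b))) $ i = (cmat E *v (cmat S *v (a * b))) $ i" for i
  proof -
    have "(cmat E *v (?v * (cmat S *v b))) $ i =
        (\<Sum>k\<in>UNIV. \<Sum>j\<in>UNIV. of_real (E $ i $ k) * (of_real (S $ k $ j) * (?v $ k * b $ j)))"
      unfolding cmat_nth[of E] vector_mult_component cmat_nth[of S b]
      by (simp add: sum_distrib_left mult_ac)
    also have "\<dots> = (cmat E *v (cmat S *v (a * b))) $ i"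
      unfolding const by (simp add: cmat_nth sum_distrib_left)
    finally show ?thesis .
  qed
  then show ?thesis by (simp add: vec_eq_iff)
qed

section \<open>Inverse matrices and resolvents\<close>

lemma invertible_iff_ker:
  fixes A :: "'a::field^'n^'n"
  shows "invertible A \<longleftrightarrow> (\<forall>v. A *v v = 0 \<longrightarrow> v = 0)"
  by (metis invertible_left_inverse matrix_left_invertible_ker)

lemma matrix_inv_right:
  fixes A :: "'a::semiring_1^'n^'m"
  assumes "invertible A" shows "A ** matrix_inv A = mat 1"
  using someI_ex[OF assms[unfolded invertible_def]] by (simp add: matrix_inv_def)

lemma matrix_inv_left:
  fixes A :: "'a::semiring_1^'n^'m"
  assumes "invertible A" shows "matrix_inv A ** A = mat 1"
  using someI_ex[OF assms[unfolded invertible_def]] by (simp add: matrix_inv_def)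

lemma matrix_inv_unique:
  fixes A :: "'a::field^'n^'n"
  assumes "A ** B = mat 1" shows "matrix_inv A = B"
proof -
  have "invertible A"
    using assms matrix_left_right_inverse[of A B] unfolding invertible_def by blast
  then have "matrix_inv A ** (A ** B) = B"
    by (simp add: matrix_mul_assoc matrix_inv_left)
  then show ?thesis by (simp add: assms)
qed

lemma matrix_inv_Cramer:
  fixes A :: "'a::field^'n^'n"
  assumes "invertible A"
  shows "matrix_inv A $ i $ j = det (\<chi> k l. if l = i then mat 1 $ k $ j else A $ k $ l) / det A"
proof -
  have "A *v (\<chi> k. matrix_inv A $ k $ j) = (\<chi> k. mat 1 $ k $ j)"
    using arg_cong[OF matrix_inv_right[OF assms], of "\<lambda>M. \<chi> k. M $ k $ j"]
    by (simp add: matrix_matrix_mult_def matrix_vector_mult_def)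
  then have "(\<chi> k. matrix_inv A $ k $ j) =
      (\<chi> i. det (\<chi> k l. if l = i then (\<chi> k. mat 1 $ k $ j) $ k else A $ k $ l) / det A)"
    using cramer assms[unfolded invertible_det_nz] by blast
  from arg_cong[OF this, of "\<lambda>v. v $ i"] show ?thesis by (simp cong: if_cong)
qed

lemma holomorphic_on_det:
  assumes "\<And>i j. (\<lambda>z. M z $ i $ j) holomorphic_on U"
  shows "(\<lambda>z. det (M z)) holomorphic_on U"
  unfolding det_def by (intro holomorphic_intros assms)

lemma tendsto_det:
  fixes M :: "'b \<Rightarrow> 'a::real_normed_field^'n^'n"
  assumes "(M \<longlongrightarrow> A) F"
  shows "((\<lambda>x. det (M x)) \<longlongrightarrow> det A) F"
  unfolding det_def by (intro tendsto_intros assms)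

lemma holomorphic_on_matrix_inv:
  fixes M :: "complex \<Rightarrow> complex^'n^'n"
  assumes hol: "\<And>i j. (\<lambda>z. M z $ i $ j) holomorphic_on U" and inv: "\<And>z. z \<in> U \<Longrightarrow> invertible (M z)"
  shows "(\<lambda>z. matrix_inv (M z) $ i $ j) holomorphic_on U"
proof -
  have "(\<lambda>z. (\<chi> k l. if l = i then mat 1 $ k $ j else M z $ k $ l) $ k $ l) holomorphic_on U" for k l
    by (cases "l = i") (simp_all add: hol)
  then have "(\<lambda>z. det (\<chi> k l. if l = i then mat 1 $ k $ j else M z $ k $ l) / det (M z)) holomorphic_on U"
    by (intro holomorphic_on_divide holomorphic_on_det hol) (use inv invertible_det_nz in blast)+
  then show ?thesis
    by (rule holomorphic_transform) (simp add: matrix_inv_Cramer inv)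
qed

lemma tendsto_matrix_inv:
  fixes M :: "'b \<Rightarrow> 'a::real_normed_field^'n^'n"
  assumes lim: "(M \<longlongrightarrow> A) F" and inv: "invertible A"
  shows "((\<lambda>x. matrix_inv (M x)) \<longlongrightarrow> matrix_inv A) F"
proof (intro vec_tendstoI)
  fix i j
  have A: "det A \<noteq> 0" using inv invertible_det_nz by blast
  have ev: "\<forall>\<^sub>F x in F. det (M x) \<noteq> 0"
    using tendsto_imp_eventually_ne[OF tendsto_det[OF lim] A] .
  have "((\<lambda>x. if l = i then mat 1 $ k $ j else M x $ k $ l) \<longlongrightarrow>
      (if l = i then mat 1 $ k $ j else A $ k $ l)) F" for k l
    by (cases "l = i") (auto intro!: tendsto_intros lim)
  then have "((\<lambda>x. det (\<chi> k l. if l = i then mat 1 $ k $ j else M x $ k $ l) / det (M x)) \<longlongrightarrow>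
      det (\<chi> k l. if l = i then mat 1 $ k $ j else A $ k $ l) / det A) F"
    by (intro tendsto_divide tendsto_det lim A tendsto_vec_lambda)
  then have "((\<lambda>x. matrix_inv (M x) $ i $ j) \<longlongrightarrow>
      det (\<chi> k l. if l = i then mat 1 $ k $ j else A $ k $ l) / det A) F"
    by (rule Lim_transform_eventually)
       (rule eventually_mono[OF ev], simp add: matrix_inv_Cramer invertible_det_nz)
  then show "((\<lambda>x. matrix_inv (M x) $ i $ j) \<longlongrightarrow> matrix_inv A $ i $ j) F"
    by (simp add: matrix_inv_Cramer inv)
qed

lemma mat_vector_mult: "mat z *v v = z *s (v :: 'a::comm_semiring_1^'n)"
  by (simp add: vec_eq_iff matrix_vector_mult_def mat_def if_distrib[of "\<lambda>x. x * _"] cong: if_cong)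

lemma mat_mult_commute: "mat z ** A = A ** mat (z :: 'a::comm_semiring_1)"
  by (simp add: vec_eq_iff matrix_matrix_mult_def mat_def if_distrib[of "\<lambda>x. x * _"]
      if_distrib[of "\<lambda>x. _ * x"] mult.commute cong: if_cong)

lemma matrix_diff_ldistrib: "A ** (B - C) = A ** B - A ** (C :: 'a::ring_1^'n^'m)"
  by (simp add: vec_eq_iff matrix_matrix_mult_def right_diff_distrib sum_subtractf)

lemma matrix_diff_rdistrib: "(B - C) ** A = B ** A - (C :: 'a::ring_1^'n^'m) ** A"
  by (simp add: vec_eq_iff matrix_matrix_mult_def left_diff_distrib sum_subtractf)

lemma resolvent_at_infinity:
  fixes T :: "complex^'n^'n"
  shows "((\<lambda>z. z * matrix_inv (mat z - T) $ i $ j) \<longlongrightarrow> mat 1 $ i $ j) at_infinity"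
proof -
  define N where "N z = (\<chi> i j. mat 1 $ i $ j - inverse z * T $ i $ j)" for z
  have "(N \<longlongrightarrow> (\<chi> i j. mat 1 $ i $ j - 0 * T $ i $ j)) at_infinity"
    unfolding N_def by (intro tendsto_intros tendsto_inverse_0)
  then have N: "(N \<longlongrightarrow> mat 1) at_infinity" by simp
  have i1: "invertible (mat 1 :: complex^'n^'n)" by (simp add: invertible_det_nz)
  have "((\<lambda>z. matrix_inv (N z) $ i $ j) \<longlongrightarrow> matrix_inv (mat 1) $ i $ j) at_infinity"
    by (intro tendsto_vec_nth tendsto_matrix_inv N i1)
  moreover have "matrix_inv (mat 1 :: complex^'n^'n) = mat 1"
    by (rule matrix_inv_unique) simp
  moreover have "\<forall>\<^sub>F z in at_infinity. matrix_inv (N z) $ i $ j = z * matrix_inv (mat z - T) $ i $ j"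
  proof (rule eventually_mono)
    show "\<forall>\<^sub>F z in at_infinity. det (N z) \<noteq> 0 \<and> z \<noteq> 0"
      by (intro eventually_conj eventually_not_equal_at_infinity
          tendsto_imp_eventually_ne[OF tendsto_det[OF N]]) simp
    fix z assume z: "det (N z) \<noteq> 0 \<and> z \<noteq> 0"
    let ?Y = "\<chi> i j. inverse z * matrix_inv (N z) $ i $ j"
    have zN: "(mat z - T) $ i $ k * (inverse z * x) = N z $ i $ k * x" for i k x
      using z by (auto simp: N_def mat_def field_simps)
    have "(mat z - T) ** ?Y = N z ** matrix_inv (N z)"
      by (simp add: vec_eq_iff matrix_matrix_mult_def zN del: vector_minus_component)
    then have "matrix_inv (mat z - T) = ?Y"
      by (intro matrix_inv_unique) (simp add: matrix_inv_right invertible_det_nz z)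
    then show "matrix_inv (N z) $ i $ j = z * matrix_inv (mat z - T) $ i $ j"
      using z by simp
  qed
  ultimately show ?thesis by (simp add: Lim_transform_eventually)
qed

text \<open>
  A closed curve that winds once around every singularity of \<open>f\<close> yields the same integral as a large
  circle, and there \<open>f z\<close> is close to \<open>c / z\<close>.
\<close>
lemma has_contour_integral_from_infinity:
  fixes f :: "complex \<Rightarrow> complex"
  assumes f: "f holomorphic_on UNIV - pts" and fin: "finite pts"
    and g: "valid_path g" "pathfinish g = pathstart g" "path_image g \<subseteq> UNIV - pts"
    and wn: "\<And>p. p \<in> pts \<Longrightarrow> winding_number g p = 1"
    and lim: "((\<lambda>z. z * f z) \<longlongrightarrow> c) at_infinity"
  shows "(f has_contour_integral 2 * pi * \<i> * c) g"
proof -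
  define s where "s = (\<Sum>p\<in>pts. residue f p)"
  have opn: "open (UNIV - pts)" using fin by (simp add: finite_imp_closed open_Diff)
  have res: "(f has_contour_integral 2 * pi * \<i> * s) \<gamma>"
    if "valid_path \<gamma>" "pathfinish \<gamma> = pathstart \<gamma>" "path_image \<gamma> \<subseteq> UNIV - pts"
      "\<And>p. p \<in> pts \<Longrightarrow> winding_number \<gamma> p = 1" for \<gamma>
  proof -
    have "contour_integral \<gamma> f = 2 * pi * \<i> * (\<Sum>p\<in>pts. winding_number \<gamma> p * residue f p)"
      by (intro Residue_theorem[of UNIV] fin f that) auto
    also have "\<dots> = 2 * pi * \<i> * s" unfolding s_def by (simp add: that(4))
    finally show ?thesis
      using contour_integrable_holomorphic_simple[OF f opn that(1,3)] has_contour_integral_integral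
      by metis
  qed
  have "cmod (s - c) \<le> e" if e: "0 < e" for e
  proof -
    obtain b where b: "\<And>z. b \<le> cmod z \<Longrightarrow> dist (z * f z) c < e"
      using tendstoD[OF lim e] unfolding eventually_at_infinity by blast
    define R where "R = Max (insert 1 (insert b (cmod ` pts))) + 1"
    have mx: "x < R" if "x \<in> insert 1 (insert b (cmod ` pts))" for x
      using Max_ge[OF _ that] fin unfolding R_def by fastforce
    have R: "1 < R" "b < R" "\<And>p. p \<in> pts \<Longrightarrow> cmod p < R"
      using mx by auto
    have "(f has_contour_integral 2 * pi * \<i> * s) (circlepath 0 R)"
    proof (rule res)
      show "path_image (circlepath 0 R) \<subseteq> UNIV - pts" using R by fastforce
      show "winding_number (circlepath 0 R) p = 1" if "p \<in> pts" for p
        using R(3)[OF that] by (intro winding_number_circlepath) simp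
    qed auto
    moreover have "((\<lambda>z. c * (1 / z)) has_contour_integral c * (2 * pi * \<i>)) (circlepath 0 R)"
    proof (rule has_contour_integral_lmul)
      have "(\<lambda>z::complex. 1 / z) contour_integrable_on circlepath 0 R"
        using R by (intro contour_integrable_holomorphic_simple[of _ "- {0}"] holomorphic_intros) auto
      moreover have "contour_integral (circlepath 0 R) (\<lambda>z. 1 / z) = 2 * pi * \<i>"
        using contour_integral_circlepath[of R 0] R by simp
      ultimately show "((\<lambda>z. 1 / z) has_contour_integral 2 * pi * \<i>) (circlepath 0 R)"
        using has_contour_integral_integral by metis
    qed
    ultimately have "((\<lambda>z. f z - c * (1 / z)) has_contour_integral 2 * pi * \<i> * s - c * (2 * pi * \<i>))
        (circlepath 0 R)"
      by (rule has_contour_integral_diff)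
    then have "cmod (2 * pi * \<i> * s - c * (2 * pi * \<i>)) \<le> e / R * (2 * pi * R)"
    proof (rule has_contour_integral_bound_circlepath)
      fix z :: complex assume "cmod (z - 0) = R"
      then have z: "cmod z = R" "z \<noteq> 0" using R by auto
      have "cmod (f z - c * (1 / z)) = dist (z * f z) c / R"
        using z by (simp add: dist_norm field_simps flip: norm_mult norm_divide z(1))
      also have "\<dots> \<le> e / R"
        using b[of z] z R by (intro divide_right_mono) auto
      finally show "cmod (f z - c * (1 / z)) \<le> e / R" .
    qed (use e R in auto)
    also have "\<dots> = 2 * pi * e" using R by simp
    also have "2 * pi * \<i> * s - c * (2 * pi * \<i>) = 2 * pi * \<i> * (s - c)" by (simp add: algebra_simps)
    finally show ?thesis by (simp add: norm_mult)
  qed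
  then have "cmod (s - c) \<le> 0" by (rule field_le_epsilon[of _ 0, simplified])
  then have "s = c" by simp
  with res[OF g wn] show ?thesis by simp
qed

text \<open>
  The matrix \<open>z - T\<close> on the range of an idempotent \<open>F\<close> commuting with \<open>T\<close>, completed by the identity
  on the kernel of \<open>F\<close>.  It is singular exactly at the eigenvalues that \<open>T\<close> has on the range
  of \<open>F\<close>, so the product of \<open>F\<close> and its inverse continues \<open>F (z - T)\<inverse>\<close> analytically to all
  other points.
\<close>
definition compress :: "complex^'n^'n \<Rightarrow> complex^'n^'n \<Rightarrow> complex \<Rightarrow> complex^'n^'n"
  where "compress F T z = (mat z - T) ** F + (mat 1 - F)"

lemma holomorphic_on_compress:
  fixes F T :: "complex^'n^'n"
  shows "(\<lambda>z. compress F T z $ i $ j) holomorphic_on U"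
proof -
  have "(\<lambda>z. (mat z :: complex^'n^'n) $ i $ j) holomorphic_on U" for i j :: 'n
    by (cases "i = j") (auto simp: mat_def intro: holomorphic_intros)
  then show ?thesis
    unfolding compress_def matrix_matrix_mult_def by (auto intro!: holomorphic_intros)
qed

lemma invertible_compress:
  assumes F: "F ** F = F" "F ** T = T ** F"
    and ev: "\<And>v. F *v v = v \<Longrightarrow> T *v v = z *s v \<Longrightarrow> v = 0"
  shows "invertible (compress F T z)"
  unfolding invertible_iff_ker
proof (intro allI impI)
  fix v assume "compress F T z *v v = 0"
  then have v: "(mat z - T) *v (F *v v) + (v - F *v v) = 0"
    by (simp add: compress_def matrix_vector_mult_add_rdistrib matrix_vector_mult_diff_rdistrib
        matrix_vector_mul_assoc)
  have "F ** (mat z - T) = (mat z - T) ** F"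
    by (simp add: matrix_diff_ldistrib matrix_diff_rdistrib F mat_mult_commute)
  then have "F *v ((mat z - T) *v (F *v v) + (v - F *v v)) = (mat z - T) *v (F *v v)"
    by (simp add: matrix_vector_right_distrib matrix_vector_mult_diff_distrib matrix_vector_mul_assoc
        matrix_mul_assoc F(1)) (simp add: matrix_mul_assoc[symmetric] F(1))
  then have zT: "(mat z - T) *v (F *v v) = 0" unfolding v by simp
  with v have Fv: "F *v v = v" by simp
  with zT have "T *v v = z *s v"
    by (simp add: matrix_vector_mult_diff_rdistrib mat_vector_mult)
  with Fv ev show "v = 0" by blast
qed

lemma compress_resolvent:
  assumes F: "F ** F = F" "F ** T = T ** F"
    and inv: "invertible (mat z - T)" "invertible (compress F T z)"
  shows "F ** matrix_inv (mat z - T) = F ** matrix_inv (compress F T z)"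
proof -
  let ?R = "matrix_inv (mat z - T)" and ?C = "compress F T z"
  have comm: "F ** (mat z - T) = (mat z - T) ** F"
    by (simp add: matrix_diff_ldistrib matrix_diff_rdistrib F mat_mult_commute)
  have "F ** ?C = (F ** (mat z - T)) ** F"
    by (simp add: compress_def matrix_add_ldistrib matrix_diff_ldistrib F(1) matrix_mul_assoc)
  also have "\<dots> = (mat z - T) ** F"
    by (simp only: comm matrix_mul_assoc[symmetric] F(1))
  finally have FC: "F ** ?C = (mat z - T) ** F" .
  have "F ** ?R = (?R ** (mat z - T)) ** F ** ?R"
    by (simp add: matrix_inv_left inv)
  also have "\<dots> = ?R ** (F ** (mat z - T)) ** ?R"
    by (simp only: comm matrix_mul_assoc)
  also have "\<dots> = ?R ** F ** ((mat z - T) ** ?R)"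
    by (simp only: matrix_mul_assoc)
  also have "\<dots> = ?R ** F ** (?C ** matrix_inv ?C)"
    by (simp add: matrix_inv_right inv)
  also have "\<dots> = ?R ** (F ** ?C) ** matrix_inv ?C"
    by (simp only: matrix_mul_assoc)
  also have "\<dots> = (?R ** (mat z - T)) ** F ** matrix_inv ?C"
    by (simp only: FC matrix_mul_assoc)
  also have "\<dots> = F ** matrix_inv ?C"
    by (simp add: matrix_inv_left inv)
  finally show ?thesis .
qed

section \<open>The peripheral spectral projection is the idempotent limit\<close>

lemma cmat_mpow_eigenvector:
  assumes "cmat S *v v = z *s v"
  shows "cmat (mpow S k) *v v = z ^ k *s v"
proof (induction k)
  case (Suc k)
  have "cmat (mpow S (Suc k)) *v v = cmat S *v (z ^ k *s v)"
    by (simp add: cmat_mult matrix_vector_mul_assoc[symmetric] Suc)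
  also have "\<dots> = z ^ k *s (cmat S *v v)" by (rule vec.scale)
  finally show ?case by (simp add: assms vector_smult_assoc mult.commute)
qed (simp add: cmat_mat_1)

lemma stochastic_eigenvalue_le_1:
  assumes "stochastic S" "cmat S *v v = z *s v" "v \<noteq> 0"
  shows "cmod z \<le> 1"
  using stochastic_spectrum(2)[OF assms(1)] assms(2,3) spectrum_iff by blast

text \<open>
  On the range of \<open>E\<close> the matrix \<open>S\<close> has only eigenvalues of modulus at least \<open>1\<close>, since \<open>B\<close> inverts
  it there and is stochastic; on the kernel of \<open>E\<close> it has only eigenvalues of modulus less than \<open>1\<close>,
  since some sequence of powers tends to \<open>0\<close>.  Write the resolvent as \<open>E R(z) + F R(z)\<close> with
  \<open>F = 1 - E\<close>.  The first summand is holomorphic in the open unit disk and integrates to \<open>0\<close>; the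
  singularities of the second all lie inside the curve, and \<open>z F R(z) \<rightarrow> F\<close> at infinity.
\<close>
lemma P_proj_eq_idempotent:
  assumes S: "stochastic S" and g: "riesz_contour (cmat S) \<gamma>"
    and E: "E ** E = E" "S ** E = E ** S"
    and B: "stochastic B" "B ** S = E"
    and lim: "(\<lambda>j. mpow S (Suc (k j))) \<longlonglongrightarrow> E"
  shows "P_proj (cmat S) \<gamma> = cmat E"
proof -
  let ?T = "cmat S" and ?E = "cmat E"
  define F where "F = mat 1 - ?E"
  have EE: "?E ** ?E = ?E" "?E ** ?T = ?T ** ?E"
    by (simp_all add: E flip: cmat_mult)
  have FF: "F ** F = F" "F ** ?T = ?T ** F"
    by (simp_all add: F_def matrix_diff_ldistrib matrix_diff_rdistrib EE)
  have gam: "valid_path \<gamma>" "pathfinish \<gamma> = pathstart \<gamma>" "path_image \<gamma> \<subseteq> ball 0 1"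
    and wn: "\<And>z. z \<in> inside (path_image \<gamma>) \<Longrightarrow> winding_number \<gamma> z = 1"
    and ins: "spectrum ?T - peripheral_spectrum ?T \<subseteq> inside (path_image \<gamma>)"
    using g by (auto simp: riesz_contour_def)
  have inside: "z \<in> inside (path_image \<gamma>)" if "z \<in> spectrum ?T" "cmod z < 1" for z
    using that ins stochastic_spr[OF S] by (auto simp: peripheral_spectrum_def)
  have inv: "invertible (mat z - ?T)" if "z \<in> path_image \<gamma>" for z
    using that inside[of z] gam(3) inside_no_overlap[of "path_image \<gamma>"]
    by (fastforce simp: spectrum_def)
  have invE: "invertible (compress ?E ?T z)" if z: "cmod z < 1" for z
  proof (rule invertible_compress[OF EE])
    fix v assume v: "?E *v v = v" "?T *v v = z *s v"
    show "v = 0"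
    proof (rule ccontr)
      assume "v \<noteq> 0"
      have "v = cmat B *v (?T *v v)"
        using v(1) by (simp add: matrix_vector_mul_assoc B(2) flip: cmat_mult)
      also have "\<dots> = z *s (cmat B *v v)" unfolding v(2) by (rule vec.scale)
      finally have zB: "z *s (cmat B *v v) = v" by simp
      then have "z \<noteq> 0" using \<open>v \<noteq> 0\<close> by auto
      then have "cmat B *v v = inverse z *s v"
        using arg_cong[OF zB, of "\<lambda>w. inverse z *s w"] by (simp add: vector_smult_assoc)
      then have "cmod (inverse z) \<le> 1"
        using stochastic_eigenvalue_le_1[OF B(1)] \<open>v \<noteq> 0\<close> by blast
      then have "1 \<le> cmod z"
        using \<open>z \<noteq> 0\<close> by (simp add: norm_inverse inverse_le_1_iff)
      with z show False by simp
    qed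
  qed
  \<comment> \<open>The eigenvalues of \<open>S\<close> on the kernel of \<open>E\<close>.\<close>
  define pts where "pts = {z. \<not> invertible (compress F ?T z)}"
  have pts: "z \<in> spectrum ?T \<and> cmod z < 1" if z: "z \<in> pts" for z
  proof -
    obtain v where v: "F *v v = v" "?T *v v = z *s v" "v \<noteq> 0"
      using invertible_compress[OF FF, of z] z unfolding pts_def by blast
    then have Ev: "?E *v v = 0"
      by (simp add: F_def matrix_vector_mult_diff_rdistrib)
    obtain i where i: "v $ i \<noteq> 0" using v(3) by (auto simp: vec_eq_iff)
    have "(\<lambda>j. (cmat (mpow S (Suc (k j))) *v v) $ i) \<longlonglongrightarrow> (?E *v v) $ i"
      unfolding matrix_vector_mult_def by (intro tendsto_intros tendsto_cmat lim)
    then have "(\<lambda>j. z ^ Suc (k j) * v $ i) \<longlonglongrightarrow> 0"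
      by (simp add: cmat_mpow_eigenvector[OF v(2)] Ev del: mpow_Suc power_Suc)
    from tendsto_norm[OF this] have lim0: "(\<lambda>j. cmod z ^ Suc (k j) * cmod (v $ i)) \<longlonglongrightarrow> 0"
      by (simp add: norm_mult norm_power del: power_Suc)
    have "cmod z < 1"
    proof (rule ccontr)
      assume "\<not> cmod z < 1"
      then have "1 * cmod (v $ i) \<le> cmod z ^ Suc (k j) * cmod (v $ i)" for j
        by (intro mult_right_mono one_le_power) auto
      then have "1 * cmod (v $ i) \<le> 0" by (intro LIMSEQ_le_const[OF lim0]) auto
      with i show False by simp
    qed
    with v show ?thesis unfolding spectrum_iff by blast
  qed
  have "((\<lambda>z. matrix_inv (mat z - ?T) $ i $ j) has_contour_integral 2 * pi * \<i> * F $ i $ j) \<gamma>" for i j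
  proof -
    \<comment> \<open>The entries of \<open>E R(z)\<close> and \<open>F R(z)\<close>, continued analytically.\<close>
    define e where "e z = (?E ** matrix_inv (compress ?E ?T z)) $ i $ j" for z
    define f where "f z = (F ** matrix_inv (compress F ?T z)) $ i $ j" for z
    have "e holomorphic_on ball 0 1"
      unfolding e_def matrix_matrix_mult_def vec_lambda_beta
      by (intro holomorphic_intros holomorphic_on_matrix_inv holomorphic_on_compress invE) auto
    then have e: "(e has_contour_integral 0) \<gamma>"
      using gam by (intro Cauchy_theorem_disc_simple)
    have f: "(f has_contour_integral 2 * pi * \<i> * F $ i $ j) \<gamma>"
    proof (rule has_contour_integral_from_infinity)
      show "f holomorphic_on UNIV - pts"
        unfolding f_def matrix_matrix_mult_def vec_lambda_beta
        by (intro holomorphic_intros holomorphic_on_matrix_inv holomorphic_on_compress)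
           (auto simp: pts_def)
      show "finite pts"
        using pts by (intro finite_subset[OF _ stochastic_spectrum(1)[OF S]]) auto
      show "path_image \<gamma> \<subseteq> UNIV - pts"
        using pts inv by (auto simp: spectrum_def)
      show "winding_number \<gamma> p = 1" if "p \<in> pts" for p
        using pts[OF that] by (intro wn inside) auto
      show "valid_path \<gamma>" "pathfinish \<gamma> = pathstart \<gamma>" by (rule gam)+
      have "((\<lambda>z. \<Sum>l\<in>UNIV. F $ i $ l * (z * matrix_inv (mat z - ?T) $ l $ j)) \<longlongrightarrow>
          (\<Sum>l\<in>UNIV. F $ i $ l * mat 1 $ l $ j)) at_infinity"
        by (intro tendsto_intros resolvent_at_infinity)
      moreover have "(\<Sum>l\<in>UNIV. F $ i $ l * mat 1 $ l $ j) = F $ i $ j"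
        using matrix_mul_rid[of F] by (simp add: matrix_matrix_mult_def vec_eq_iff)
      moreover have "\<forall>\<^sub>F z in at_infinity.
          (\<Sum>l\<in>UNIV. F $ i $ l * (z * matrix_inv (mat z - ?T) $ l $ j)) = z * f z"
        unfolding eventually_at_infinity
      proof (intro exI[of _ 2] allI impI)
        fix z :: complex assume z: "2 \<le> cmod z"
        then have "invertible (mat z - ?T)"
          using stochastic_spectrum(2)[OF S, of z] by (auto simp: spectrum_def)
        moreover have "invertible (compress F ?T z)"
          using pts[of z] z by (auto simp: pts_def)
        ultimately have "f z = (F ** matrix_inv (mat z - ?T)) $ i $ j"
          unfolding f_def by (simp only: compress_resolvent[OF FF])
        then show "(\<Sum>l\<in>UNIV. F $ i $ l * (z * matrix_inv (mat z - ?T) $ l $ j)) = z * f z"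
          by (simp add: matrix_matrix_mult_def sum_distrib_left mult_ac)
      qed
      ultimately show "((\<lambda>z. z * f z) \<longlongrightarrow> F $ i $ j) at_infinity"
        by (simp add: Lim_transform_eventually)
    qed
    show ?thesis
    proof (rule has_contour_integral_eq)
      show "((\<lambda>z. e z + f z) has_contour_integral 2 * pi * \<i> * F $ i $ j) \<gamma>"
        using has_contour_integral_add[OF e f] by simp
      fix z assume z: "z \<in> path_image \<gamma>"
      let ?R = "matrix_inv (mat z - ?T)"
      have "invertible (compress ?E ?T z)" using invE z gam(3) by (auto simp: subset_iff)
      then have ez: "e z = (?E ** ?R) $ i $ j"
        unfolding e_def using compress_resolvent[OF EE inv[OF z]] by simp
      have "z \<notin> pts" using pts[of z] inv[OF z] by (auto simp: spectrum_def)
      then have fz: "f z = (F ** ?R) $ i $ j"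
        unfolding f_def using compress_resolvent[OF FF inv[OF z]] by (simp add: pts_def)
      have "?E ** ?R + F ** ?R = ?R"
        by (simp add: F_def matrix_diff_rdistrib)
      then show "e z + f z = ?R $ i $ j"
        unfolding ez fz by (metis vector_add_component)
    qed
  qed
  from contour_integral_unique[OF this] have "Q_proj ?T \<gamma> = F"
    by (simp add: Q_proj_def vec_eq_iff)
  then show ?thesis by (simp add: P_proj_def F_def)
qed

section \<open>The sup norm\<close>

lemma sup_norm_ge: "cmod (a $ i) \<le> sup_norm a"
  unfolding sup_norm_def by (rule Max_ge) auto

lemma sup_norm_attained: obtains i where "sup_norm a = cmod (a $ i)"
  using Max_in[of "range (\<lambda>i. cmod (a $ i))"] unfolding sup_norm_def by fastforce

lemma sup_norm_nonneg: "0 \<le> sup_norm a"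
  using order_trans[OF norm_ge_zero sup_norm_ge] .

lemma sup_norm_le_iff: "sup_norm a \<le> c \<longleftrightarrow> (\<forall>i. cmod (a $ i) \<le> c)"
  unfolding sup_norm_def by (subst Max_le_iff) auto

lemma sup_norm_stochastic_le:
  assumes S: "stochastic S" shows "sup_norm (cmat S *v a) \<le> sup_norm a"
  unfolding sup_norm_le_iff
proof
  fix i
  have "cmod ((cmat S *v a) $ i) \<le> (\<Sum>j\<in>UNIV. cmod (of_real (S $ i $ j) * a $ j))"
    unfolding cmat_nth by (rule norm_sum)
  also have "\<dots> \<le> (\<Sum>j\<in>UNIV. S $ i $ j * sup_norm a)"
    by (intro sum_mono) (simp add: norm_mult stochastic_nonneg[OF S] sup_norm_ge mult_left_mono)
  also have "\<dots> = sup_norm a"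
    by (simp add: stochastic_row_sum[OF S] flip: sum_distrib_right)
  finally show "cmod ((cmat S *v a) $ i) \<le> sup_norm a" .
qed

lemma sup_norm_mult_le: "sup_norm (a * b) \<le> sup_norm a * sup_norm b"
  unfolding sup_norm_le_iff
proof
  fix i
  show "cmod ((a * b) $ i) \<le> sup_norm a * sup_norm b"
    by (simp add: norm_mult mult_mono sup_norm_ge sup_norm_nonneg)
qed

lemma sup_norm_convergent:
  assumes "\<And>e. e > 0 \<Longrightarrow> \<exists>N. \<forall>j\<ge>N. \<forall>k\<ge>N. sup_norm (X j - X k) < e"
  obtains x where "X \<longlonglongrightarrow> x" "(\<lambda>k. sup_norm (X k - x)) \<longlonglongrightarrow> 0"
proof -
  have "Cauchy (\<lambda>k. X k $ i)" for i
  proof (rule CauchyI)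
    fix e :: real assume "0 < e"
    then obtain N where "\<And>j k. N \<le> j \<Longrightarrow> N \<le> k \<Longrightarrow> sup_norm (X j - X k) < e"
      using assms by blast
    then show "\<exists>N. \<forall>j\<ge>N. \<forall>k\<ge>N. norm (X j $ i - X k $ i) < e"
      using sup_norm_ge[of "X j - X k" i for j k] by (metis order_le_less_trans vector_minus_component)
  qed
  then have "\<exists>l. (\<lambda>k. X k $ i) \<longlonglongrightarrow> l" for i
    using Cauchy_convergent convergent_def by blast
  then obtain l where l: "\<And>i. (\<lambda>k. X k $ i) \<longlonglongrightarrow> l i" by metis
  then have X: "X \<longlonglongrightarrow> (\<chi> i. l i)"
    by (intro vec_tendstoI) simp
  have "(\<lambda>k. sup_norm (X k - (\<chi> i. l i))) \<longlonglongrightarrow> 0"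
  proof (rule tendsto_sandwich[OF _ _ tendsto_const])
    show "(\<lambda>k. norm (X k - (\<chi> i. l i))) \<longlonglongrightarrow> 0"
      using X by (simp add: LIM_zero tendsto_norm_zero)
    show "\<forall>\<^sub>F k in sequentially. sup_norm (X k - (\<chi> i. l i)) \<le> norm (X k - (\<chi> i. l i))"
      unfolding sup_norm_le_iff by (intro always_eventually allI Finite_Cartesian_Product.norm_nth_le)
    show "\<forall>\<^sub>F k in sequentially. 0 \<le> sup_norm (X k - (\<chi> i. l i))"
      by (intro always_eventually allI sup_norm_nonneg)
  qed
  with X show thesis using that by blast
qed

section \<open>The algebra on the range of a stochastic idempotent\<close>

lemma cring_complex_ring: "cring complex_ring"
proof (rule cringI)
  show "abelian_group complex_ring"
  proof (rule abelian_groupI)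
    show "\<exists>y\<in>carrier complex_ring. y \<oplus>\<^bsub>complex_ring\<^esub> x = \<zero>\<^bsub>complex_ring\<^esub>" for x
      by (rule bexI[of _ "- x"]) (auto simp: complex_ring_def)
  qed (auto simp: complex_ring_def)
  show "comm_monoid complex_ring"
    by (rule comm_monoidI) (auto simp: complex_ring_def)
qed (auto simp: complex_ring_def algebra_simps)

lemma range_idempotent_iff:
  assumes "E ** E = E"
  shows "a \<in> range (\<lambda>a. cmat E *v a) \<longleftrightarrow> cmat E *v a = a"
proof
  assume "a \<in> range (\<lambda>a. cmat E *v a)"
  then show "cmat E *v a = a"
    by (auto simp: matrix_vector_mul_assoc assms cmat_mult[symmetric])
next
  assume "cmat E *v a = a"
  then show "a \<in> range (\<lambda>a. cmat E *v a)" by (metis rangeI)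
qed

lemma cmat_cnj_vec: "cmat S *v cnj_vec a = cnj_vec (cmat S *v a)"
  by (simp add: vec_eq_iff cnj_vec_def cmat_nth)

text \<open>
  The Choi--Effros identity, which makes the product \<open>E (a b)\<close> on the range of \<open>E\<close> associative: it is
  the case \<open>S = B = E\<close> of the multiplicativity above.
\<close>
lemma choi_effros_identity:
  assumes E: "stochastic E" "E ** E = E" and a: "cmat E *v a = a"
  shows "cmat E *v (a * (cmat E *v b)) = cmat E *v (a * b)"
  using stochastic_multiplicative_domain[OF E E(1) E, of a b] a
  by (simp add: matrix_vector_mul_assoc E flip: cmat_mult)

text \<open>
  In the C*-identity \<open>\<parallel>E (x\<^sup>* x)\<parallel> = \<parallel>x\<parallel>\<^sup>2\<close> the bound from below is the Schwarz inequality
  \<open>|x|\<^sup>2 = |E x|\<^sup>2 \<le> E (x\<^sup>* x)\<close>.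
\<close>
lemma abelian_cstar_algebra_range:
  fixes E :: "real^'n^'n"
  assumes E: "stochastic E" "E ** E = E"
  shows "abelian_cstar_algebra (range_algebra (cmat E))"
proof -
  let ?A = "range_algebra (cmat E)"
  have carr: "x \<in> carrier ?A \<longleftrightarrow> cmat E *v x = x" for x
    by (simp add: range_algebra_def range_idempotent_iff[OF E(2)])
  have sel: "\<And>x y. x \<otimes>\<^bsub>?A\<^esub> y = cmat E *v (x * y)" "\<one>\<^bsub>?A\<^esub> = 1" "\<zero>\<^bsub>?A\<^esub> = 0"
    "\<And>x y. x \<oplus>\<^bsub>?A\<^esub> y = x + y" "\<And>c x. c \<odot>\<^bsub>?A\<^esub> x = c *s x"
    "star ?A = cnj_vec" "cnorm ?A = sup_norm"
    by (simp_all add: range_algebra_def)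
  have idem: "cmat E *v (cmat E *v x) = cmat E *v x" for x
    by (simp add: matrix_vector_mul_assoc E flip: cmat_mult)
  have CE: "cmat E *v (x * (cmat E *v y)) = cmat E *v (x * y)" if "cmat E *v x = x" for x y
    by (rule choi_effros_identity[OF E that])
  have smult: "cmat E *v (c *s x) = c *s (cmat E *v x)" for c x by (rule vec.scale)
  have group: "abelian_group ?A"
  proof (rule abelian_groupI)
    fix x assume x: "x \<in> carrier ?A"
    show "\<exists>y\<in>carrier ?A. y \<oplus>\<^bsub>?A\<^esub> x = \<zero>\<^bsub>?A\<^esub>"
      by (rule bexI[of _ "- x"]) (use x smult[of "-1" x] in \<open>auto simp: sel carr\<close>)
  qed (auto simp: sel carr matrix_vector_right_distrib algebra_simps)
  have monoid: "comm_monoid ?A"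
  proof (rule comm_monoidI)
    fix x y z assume "x \<in> carrier ?A" "y \<in> carrier ?A" "z \<in> carrier ?A"
    then show "x \<otimes>\<^bsub>?A\<^esub> y \<otimes>\<^bsub>?A\<^esub> z = x \<otimes>\<^bsub>?A\<^esub> (y \<otimes>\<^bsub>?A\<^esub> z)"
      using CE[of x "y * z"] CE[of z "x * y"] by (simp add: sel carr mult_ac)
  qed (auto simp: sel carr idem mult.commute cmat_stochastic_one[OF E(1)])
  have cring: "cring ?A"
    by (rule cringI[OF group monoid]) (auto simp: sel distrib_right matrix_vector_right_distrib)
  have algebra: "Module.algebra complex_ring ?A"
  proof (rule algebraI[OF cring_complex_ring cring])
    fix c :: complex and x y :: "complex^'n"
    have "(c *s x) * y = c *s (x * y)" by (simp add: vec_eq_iff mult.assoc)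
    then show "(c \<odot>\<^bsub>?A\<^esub> x) \<otimes>\<^bsub>?A\<^esub> y = c \<odot>\<^bsub>?A\<^esub> (x \<otimes>\<^bsub>?A\<^esub> y)"
      by (simp only: sel smult)
    show "x \<in> carrier ?A \<Longrightarrow> c \<odot>\<^bsub>?A\<^esub> x \<in> carrier ?A" by (simp only: sel carr smult)
  qed (auto simp: sel complex_ring_def vec.scale_left_distrib vec.scale_right_distrib)
  have minus: "x \<ominus>\<^bsub>?A\<^esub> y = x - y" if "x \<in> carrier ?A" "y \<in> carrier ?A" for x y
  proof -
    interpret abelian_group ?A by (rule group)
    have "- y \<in> carrier ?A" using that(2) smult[of "-1" y] by (simp add: carr)
    then have "\<ominus>\<^bsub>?A\<^esub> y = - y" using that(2) by (intro minus_equality) (auto simp: sel)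
    then show ?thesis by (simp add: a_minus_def sel)
  qed
  interpret Module.algebra complex_ring ?A by (rule algebra)
  show ?thesis
  proof (unfold_locales, unfold sel carr)
    fix x y :: "complex^'n" and c :: complex
    show "cmat E *v cnj_vec x = cnj_vec x" if "cmat E *v x = x"
      by (simp add: cmat_cnj_vec that)
    show "cnj_vec (cnj_vec x) = x" "cnj_vec (x + y) = cnj_vec x + cnj_vec y"
      "cnj_vec (c *s x) = cnj c *s cnj_vec x"
      by (simp_all add: cnj_vec_def vec_eq_iff)
    show "cnj_vec (cmat E *v (x * y)) = cmat E *v (cnj_vec y * cnj_vec x)"
      unfolding cmat_cnj_vec[symmetric] by (rule arg_cong[of _ _ "(*v) (cmat E)"])
        (simp add: cnj_vec_def vec_eq_iff mult.commute)
    show "0 \<le> sup_norm x" by (rule sup_norm_nonneg)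
    show "sup_norm x = 0 \<longleftrightarrow> x = 0"
    proof
      assume "sup_norm x = 0"
      with sup_norm_ge[of x] show "x = 0" by (simp add: vec_eq_iff)
    qed (simp add: sup_norm_def)
    show "sup_norm (c *s x) = cmod c * sup_norm x"
    proof (rule antisym)
      show "sup_norm (c *s x) \<le> cmod c * sup_norm x"
        unfolding sup_norm_le_iff by (simp add: norm_mult mult_left_mono sup_norm_ge)
      obtain i where "sup_norm x = cmod (x $ i)" by (rule sup_norm_attained)
      then show "cmod c * sup_norm x \<le> sup_norm (c *s x)"
        using sup_norm_ge[of "c *s x" i] by (simp add: norm_mult)
    qed
    show "sup_norm (x + y) \<le> sup_norm x + sup_norm y"
      unfolding sup_norm_le_iff
      by (auto intro!: order_trans[OF norm_triangle_ineq] add_mono sup_norm_ge)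
    show "sup_norm (cmat E *v (x * y)) \<le> sup_norm x * sup_norm y"
      using sup_norm_stochastic_le[OF E(1)] sup_norm_mult_le order_trans by blast
    show "sup_norm (cmat E *v (cnj_vec x * x)) = (sup_norm x)\<^sup>2" if x: "cmat E *v x = x"
    proof (rule antisym)
      have "sup_norm (cnj_vec x) \<le> sup_norm x"
        unfolding sup_norm_le_iff by (simp add: cnj_vec_def sup_norm_ge)
      then have "sup_norm (cnj_vec x * x) \<le> (sup_norm x)\<^sup>2"
        using sup_norm_mult_le[of "cnj_vec x" x] mult_right_mono[OF _ sup_norm_nonneg[of x]]
        by (fastforce simp: power2_eq_square)
      then show "sup_norm (cmat E *v (cnj_vec x * x)) \<le> (sup_norm x)\<^sup>2"
        using sup_norm_stochastic_le[OF E(1)] order_trans by blast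
      obtain i where i: "sup_norm x = cmod (x $ i)" by (rule sup_norm_attained)
      have "(cmod (x $ i))\<^sup>2 \<le> (E *v abs2 x) $ i"
        using stochastic_Schwarz[OF E(1), of x i] by (simp add: x)
      also have "\<dots> \<le> cmod (complex_of_real ((E *v abs2 x) $ i))" by simp
      also have "complex_of_real ((E *v abs2 x) $ i) = (cmat E *v (cnj_vec x * x)) $ i"
        unfolding cmat_nth by (simp add: matrix_vector_mult_def abs2_def cnj_vec_def
            complex_norm_square mult.commute del: of_real_power)
      also have "cmod \<dots> \<le> sup_norm (cmat E *v (cnj_vec x * x))" by (rule sup_norm_ge)
      finally show "(sup_norm x)\<^sup>2 \<le> sup_norm (cmat E *v (cnj_vec x * x))" unfolding i .
    qed
  next
    fix X :: "nat \<Rightarrow> complex^'n"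
    assume X: "\<And>k. cmat E *v X k = X k"
      and C: "\<And>e. 0 < e \<Longrightarrow> \<exists>N. \<forall>j\<ge>N. \<forall>k\<ge>N. sup_norm (X j \<ominus>\<^bsub>?A\<^esub> X k) < e"
    obtain x where x: "X \<longlonglongrightarrow> x" "(\<lambda>k. sup_norm (X k - x)) \<longlonglongrightarrow> 0"
      using sup_norm_convergent[of X] C by (auto simp: minus carr X)
    have "(\<lambda>k. cmat E *v X k) \<longlonglongrightarrow> cmat E *v x"
      unfolding matrix_vector_mult_def by (intro tendsto_intros x)
    then have "cmat E *v x = x" using LIMSEQ_unique x(1) unfolding X by blast
    with x(2) show "\<exists>x\<in>carrier ?A. (\<lambda>k. sup_norm (X k \<ominus>\<^bsub>?A\<^esub> x)) \<longlonglongrightarrow> 0"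
      by (intro bexI[of _ x]) (simp_all add: minus carr X)
  qed
qed

section \<open>The restriction is an automorphism\<close>

theorem theorem4p2:
  fixes S :: "real^'n^'n" and \<gamma> :: "real \<Rightarrow> complex"
  assumes "stochastic S" and "riesz_contour (cmat S) \<gamma>"
  shows "star_automorphism (peripheral_algebra S \<gamma>)
           (restrict (\<lambda>a. cmat S *v a) (carrier (peripheral_algebra S \<gamma>)))"
proof -
  note S = assms(1)
  obtain E B k where E: "stochastic E" "E ** E = E" and B: "stochastic B" "S ** B = E" "B ** S = E"
    and comm: "S ** E = E ** S" "B ** E = E ** B" and lim: "(\<lambda>j. mpow S (Suc (k j))) \<longlonglongrightarrow> E"
    using stochastic_idempotent_limit[OF S] by metis
  define A where "A = range_algebra (cmat E)"
  have A: "peripheral_algebra S \<gamma> = A"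
    by (simp add: A_def peripheral_algebra_def P_proj_eq_idempotent[OF assms E(2) comm(1) B(1,3) lim])
  let ?f = "restrict (\<lambda>a. cmat S *v a) (carrier A)"
  have carr: "x \<in> carrier A \<longleftrightarrow> cmat E *v x = x" for x
    by (simp add: A_def range_algebra_def range_idempotent_iff[OF E(2)])
  have sel: "\<And>x y. x \<otimes>\<^bsub>A\<^esub> y = cmat E *v (x * y)" "\<one>\<^bsub>A\<^esub> = 1"
    "\<And>x y. x \<oplus>\<^bsub>A\<^esub> y = x + y" "\<And>c x. c \<odot>\<^bsub>A\<^esub> x = c *s x" "star A = cnj_vec"
    by (simp_all add: A_def range_algebra_def)
  interpret abelian_cstar_algebra A
    unfolding A_def by (rule abelian_cstar_algebra_range[OF E])
  have commS: "cmat E *v (cmat S *v x) = cmat S *v (cmat E *v x)"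
    and commB: "cmat E *v (cmat B *v x) = cmat B *v (cmat E *v x)"
    and SB: "cmat S *v (cmat B *v x) = cmat E *v x"
    and BS: "cmat B *v (cmat S *v x) = cmat E *v x" for x
    by (simp_all add: matrix_vector_mul_assoc comm B flip: cmat_mult)
  have S_closed: "cmat S *v x \<in> carrier A" if "x \<in> carrier A" for x
    using that by (simp add: carr commS)
  have "bij_betw ?f (carrier A) (carrier A)"
    by (rule bij_betw_byWitness[of _ "\<lambda>a. cmat B *v a"]) (auto simp: S_closed carr commS commB SB BS)
  moreover have "?f \<in> ring_hom A A"
  proof (rule ring_hom_memI)
    fix x y assume x: "x \<in> carrier A" and y: "y \<in> carrier A"
    show "?f x \<in> carrier A" using x S_closed by simp
    show "?f (x \<oplus>\<^bsub>A\<^esub> y) = ?f x \<oplus>\<^bsub>A\<^esub> ?f y"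
      using x y by (simp add: sel carr matrix_vector_right_distrib)
    have "cmat E *v ((cmat S *v x) * (cmat S *v y)) = cmat E *v (cmat S *v (x * y))"
      using x by (intro stochastic_multiplicative_domain[OF E S B(1,2)]) (simp add: BS carr)
    then show "?f (x \<otimes>\<^bsub>A\<^esub> y) = ?f x \<otimes>\<^bsub>A\<^esub> ?f y"
      using x y m_closed[OF x y] by (simp add: sel commS)
  next
    show "?f \<one>\<^bsub>A\<^esub> = \<one>\<^bsub>A\<^esub>"
      using one_closed by (simp add: sel cmat_stochastic_one[OF S])
  qed
  ultimately have "?f \<in> ring_iso A A" by (simp add: ring_iso_def)
  then show ?thesis
    unfolding A
  proof (unfold_locales, goal_cases)
    case (2 x c)
    then show ?case using smult_closed[of c x] by (simp add: sel complex_ring_def vec.scale)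
  next
    case (3 x)
    then show ?case using star_closed[of x] by (simp add: sel cmat_cnj_vec)
  qed
qed

end
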